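(* Let $\lambda\in\mathbb{C}^*$, $\beta(y)=\sum_{i\ge0}\beta_iy^i\in\mathbb{C}[y]$, and let $\Psi_{\mathfrak{hv}}(\lambda,\beta)=\mathbb{C}[x,y]$ be the associated module over the Heisenberg-Virasoro algebra $\mathfrak{hv}$. For $g(y)\in\mathbb{C}[y]$ let $R_g^{\mathfrak{hv}}=g(y)\mathbb{C}[x,y]$ and $S_g^{\mathfrak{hv}}=g(y)\big(x\mathbb{C}[x,y]+y\mathbb{C}[x,y]\big)$, subspaces of $\Psi_{\mathfrak{hv}}(\lambda,\beta)$. Then: (1) If $\beta_0\neq0$, the set $\{R_g^{\mathfrak{hv}}\mid g(y)\in\mathbb{C}[y]\}$ exhausts all $\mathfrak{hv}$-submodules of $\Psi_{\mathfrak{hv}}(\lambda,\beta)$; moreover $R_g^{\mathfrak{hv}}\subseteq R_{\hat g}^{\mathfrak{hv}}$ for any $g(y),\hat g(y)\in\mathbb{C}[y]$ with $\hat g(y)\mid g(y)$. If $\beta_0=0$, the set $\{R_g^{\mathfrak{hv}},S_g^{\mathfrak{hv}}\mid g(y)\in\mathbb{C}[y]\}$ exhausts all $\mathfrak{hv}$-submodules of $\Psi_{\mathfrak{hv}}(\lambda,\beta)$; moreover $S_g^{\mathfrak{hv}}\subseteq R_g^{\mathfrak{hv}}\subseteq R_{\hat g}^{\mathfrak{hv}}$ for any $g(y),\hat g(y)\in\mathbb{C}[y]$ with $\hat g(y)\mid g(y)$. (2) For any nonzero $g(y)\in\mathbb{C}[y]$, the quotient module $\Psi_{\mathfrak{hv}}(\lambda,\beta)/R_g^{\mathfrak{hv}}$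 is a free $\mathbb{C}[L_0]$-module of rank $\deg g(y)$. Any maximal submodule of $\Psi_{\mathfrak{hv}}(\lambda,\beta)$ is of the form $R_g^{\mathfrak{hv}}$ for some $g(y)\in\mathbb{C}[y]$ with $\deg g(y)=1$.
   Context: All vector spaces are over $\mathbb{C}$; $\mathbb{C}^*$ is the set of nonzero complex numbers. The Heisenberg-Virasoro algebra $\mathfrak{hv}$ is the Lie algebra with basis $L_m,H_m$ ($m\in\mathbb{Z}$), $C_1,C_2,C_3$ and brackets $[L_m,L_n]=(m-n)L_{m+n}+\delta_{m+n,0}\frac{m^3-m}{12}C_1$, $[L_m,H_n]=-nH_{m+n}+\delta_{m+n,0}(m^2+m)C_2$, $[H_m,H_n]=m\delta_{m+n,0}C_3$, with $C_1,C_2,C_3$ central. For $\lambda\in\mathbb{C}^*$ and $\beta(y)\in\mathbb{C}[y]$, $\Psi_{\mathfrak{hv}}(\lambda,\beta)=\mathbb{C}[x,y]$ is the $\mathfrak{hv}$-module with actions $L_mf(x,y)=\lambda^m(x+m\beta(y))f(x+m,y)$, $H_mf(x,y)=\lambda^myf(x+m,y)$, $C_if(x,y)=0$ for $f(x,y)\in\mathbb{C}[x,y]$, $m\in\mathbb{Z}$, $i=1,2,3$.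
   Formalization: The last sentence of (2) fails when β_0=0, since S_1=xC[x,y]+yC[x,y] is then a maximal submodule not of the form R_g with deg g=1; the formal version says any maximal submodule is R_g with deg g=1, or β_0=0 and it equals S_1. *)

theory Defs
  imports
    "HOL-Library.Poly_Mapping"
    "HOL-Library.Set_Algebras"
    "HOL-Library.FuncSet"
    "HOL-Computational_Algebra.Polynomial"
    "HOL-Algebra.Module"
    "HOL-Algebra.Algebraic_Closure_Type"
begin

hide_const (open) Polynomial.smult

section \<open>Lie algebras and their modules\<close>

locale lie_algebra = vector_space gscale
  for gscale :: "'k::field \<Rightarrow> 'g::ab_group_add \<Rightarrow> 'g" +
  fixes bracket :: "'g \<Rightarrow> 'g \<Rightarrow> 'g"
  assumes bracket_add_left: "bracket (a + b) c = bracket a c + bracket b c"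
    and bracket_add_right: "bracket a (b + c) = bracket a b + bracket a c"
    and bracket_scale_left: "bracket (gscale r a) b = gscale r (bracket a b)"
    and bracket_scale_right: "bracket a (gscale r b) = gscale r (bracket a b)"
    and bracket_self: "bracket a a = 0"
    and jacobi: "bracket a (bracket b c) + bracket b (bracket c a) + bracket c (bracket a b) = 0"

locale lie_module = lie_algebra gscale bracket + V: vector_space vscale
  for gscale :: "'k::field \<Rightarrow> 'g::ab_group_add \<Rightarrow> 'g"
    and bracket :: "'g \<Rightarrow> 'g \<Rightarrow> 'g"
    and vscale :: "'k \<Rightarrow> 'v::ab_group_add \<Rightarrow> 'v" +
  fixes act :: "'g \<Rightarrow> 'v \<Rightarrow> 'v"
  assumes act_add_left: "act (a + b) v = act a v + act b v"
    and act_add_right: "act a (v + w) = act a v + act a w"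
    and act_scale_left: "act (gscale r a) v = vscale r (act a v)"
    and act_scale_right: "act a (vscale r v) = vscale r (act a v)"
    and act_bracket: "act (bracket a b) v = act a (act b v) - act b (act a v)"
begin

definition lie_submodule :: "'v set \<Rightarrow> bool"
  where "lie_submodule W \<longleftrightarrow> V.subspace W \<and> (\<forall>a. \<forall>w\<in>W. act a w \<in> W)"

definition maximal_lie_submodule :: "'v set \<Rightarrow> bool"
  where "maximal_lie_submodule W \<longleftrightarrow>
    lie_submodule W \<and> W \<noteq> UNIV \<and>
    (\<forall>W'. lie_submodule W' \<and> W \<subseteq> W' \<longrightarrow> W' = W \<or> W' = UNIV)"

definition poly_act :: "'g \<Rightarrow> 'k poly \<Rightarrow> 'v \<Rightarrow> 'v"
  where "poly_act a p v = (\<Sum>i\<le>degree p. vscale (coeff p i) ((act a ^^ i) v))"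

text \<open>
  The quotient of the module by \<open>W\<close>, regarded as a module over the polynomial ring \<open>k[a]\<close>:
  its elements are the cosets \<open>v +o W\<close>, and a polynomial \<open>p\<close> sends \<open>v +o W\<close> to
  \<open>p(a) v +o W\<close>. The fields \<open>mult\<close> and \<open>one\<close> of the record are not used by
  \<open>Module.module\<close>.
\<close>

definition quotient_over_poly :: "'g \<Rightarrow> 'v set \<Rightarrow> ('k poly, 'v set) module"
  where "quotient_over_poly a W =
    \<lparr>carrier = range (\<lambda>v. v +o W), monoid.mult = undefined, one = undefined,
     zero = W, add = (+), smult = (\<lambda>p A. poly_act a p ` A + W)\<rparr>"

end

definition free_module_of_rank ::
    "('a, 'c) ring_scheme \<Rightarrow> ('a, 'b, 'd) module_scheme \<Rightarrow> nat \<Rightarrow> bool"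
  where "free_module_of_rank R M n \<longleftrightarrow>
    Module.module R M \<and>
    (\<exists>B \<subseteq> carrier M. finite B \<and> card B = n \<and>
      (\<forall>v \<in> carrier M. \<exists>!c. c \<in> B \<rightarrow>\<^sub>E carrier R \<and> v = (\<Oplus>\<^bsub>M\<^esub>b\<in>B. c b \<odot>\<^bsub>M\<^esub> b)))"


section \<open>The Heisenberg-Virasoro algebra\<close>

datatype hv_basis = L int | H int | C1 | C2 | C3

type_synonym hv = "hv_basis \<Rightarrow>\<^sub>0 complex"

definition hv_scale :: "complex \<Rightarrow> hv \<Rightarrow> hv"
  where "hv_scale c = Poly_Mapping.map ((*) c)"

fun hv_basis_bracket :: "hv_basis \<Rightarrow> hv_basis \<Rightarrow> hv" where
  "hv_basis_bracket (L m) (L n) =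
     Poly_Mapping.single (L (m + n)) (of_int (m - n)) +
     (if m + n = 0 then Poly_Mapping.single C1 (of_int (m ^ 3 - m) / 12) else 0)"
| "hv_basis_bracket (L m) (H n) =
     Poly_Mapping.single (H (m + n)) (- of_int n) +
     (if m + n = 0 then Poly_Mapping.single C2 (of_int (m\<^sup>2 + m)) else 0)"
| "hv_basis_bracket (H n) (L m) =
     - (Poly_Mapping.single (H (m + n)) (- of_int n) +
        (if m + n = 0 then Poly_Mapping.single C2 (of_int (m\<^sup>2 + m)) else 0))"
| "hv_basis_bracket (H m) (H n) =
     (if m + n = 0 then Poly_Mapping.single C3 (of_int m) else 0)"
| "hv_basis_bracket _ _ = 0"

definition lin_ext :: "('k::zero \<Rightarrow> 'v \<Rightarrow> 'v::comm_monoid_add) \<Rightarrow> ('b \<Rightarrow> 'v) \<Rightarrow> ('b \<Rightarrow>\<^sub>0 'k) \<Rightarrow> 'v"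
  where "lin_ext sc F a = (\<Sum>i\<in>Poly_Mapping.keys a. sc (Poly_Mapping.lookup a i) (F i))"

definition hv_bracket :: "hv \<Rightarrow> hv \<Rightarrow> hv"
  where "hv_bracket a b =
    lin_ext hv_scale (\<lambda>i. lin_ext hv_scale (hv_basis_bracket i) b) a"


section \<open>The module \<open>\<Psi>(\<lambda>, \<beta>)\<close>\<close>

text \<open>
  \<open>\<complex>[x,y]\<close> is represented as \<open>\<complex>[y][x]\<close>: the outer variable is \<open>x\<close>, and a polynomial
  \<open>g(y)\<close> is embedded as the constant \<open>[:g:]\<close>. Hence \<open>f(x + m, y)\<close> is the composition of \<open>f\<close>
  with \<open>x + m\<close>.
\<close>

abbreviation x_var :: "complex poly poly" where "x_var \<equiv> [:0, 1:]"

abbreviation y_var :: "complex poly poly" where "y_var \<equiv> [:[:0, 1:]:]"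

definition poly2_scale :: "complex \<Rightarrow> complex poly poly \<Rightarrow> complex poly poly"
  where "poly2_scale c f = [:[:c:]:] * f"

fun Psi_basis :: "complex \<Rightarrow> complex poly \<Rightarrow> hv_basis \<Rightarrow> complex poly poly \<Rightarrow> complex poly poly"
where
  "Psi_basis lam \<beta> (L m) f =
     poly2_scale (lam powi m) ((x_var + of_int m * [:\<beta>:]) * pcompose f (x_var + of_int m))"
| "Psi_basis lam \<beta> (H m) f = poly2_scale (lam powi m) (y_var * pcompose f (x_var + of_int m))"
| "Psi_basis lam \<beta> _ f = 0"

definition Psi :: "complex \<Rightarrow> complex poly \<Rightarrow> hv \<Rightarrow> complex poly poly \<Rightarrow> complex poly poly"
  where "Psi lam \<beta> a f = lin_ext poly2_scale (\<lambda>i. Psi_basis lam \<beta> i f) a"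

definition R_sub :: "complex poly \<Rightarrow> complex poly poly set"
  where "R_sub g = {[:g:] * f | f. True}"

definition S_sub :: "complex poly \<Rightarrow> complex poly poly set"
  where "S_sub g = {[:g:] * (x_var * p + y_var * q) | p q. True}"


abbreviation hv_submodule :: "complex \<Rightarrow> complex poly \<Rightarrow> complex poly poly set \<Rightarrow> bool"
  where "hv_submodule lam \<beta> \<equiv> lie_module.lie_submodule poly2_scale (Psi lam \<beta>)"

abbreviation maximal_hv_submodule :: "complex \<Rightarrow> complex poly \<Rightarrow> complex poly poly set \<Rightarrow> bool"
  where "maximal_hv_submodule lam \<beta> \<equiv> lie_module.maximal_lie_submodule poly2_scale (Psi lam \<beta>)"

text \<open>\<open>L0_quotient lam \<beta> W\<close> is \<open>\<Psi>(\<lambda>, \<beta>) / W\<close> as a \<open>\<complex>[L\<^sub>0]\<close>-module.\<close>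

abbreviation L0_quotient ::
    "complex \<Rightarrow> complex poly \<Rightarrow> complex poly poly set \<Rightarrow> (complex poly, complex poly poly set) module"
  where "L0_quotient lam \<beta> W \<equiv>
    lie_module.quotient_over_poly poly2_scale (Psi lam \<beta>) (Poly_Mapping.single (L 0) 1) W"


section \<open>\<open>hv\<close> is a Lie algebra and \<open>\<Psi>(\<lambda>, \<beta>)\<close> is a module over it\<close>

lemma lookup_hv_scale [simp]: "Poly_Mapping.lookup (hv_scale c a) i = c * Poly_Mapping.lookup a i"
  by (simp add: hv_scale_def Poly_Mapping.map.rep_eq when_def)

lemma vector_space_hv_scale: "vector_space hv_scale"
  by unfold_locales (auto intro!: poly_mapping_eqI simp: lookup_add algebra_simps)

lemma vector_space_poly2_scale: "vector_space poly2_scale"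
  by unfold_locales (simp_all add: poly2_scale_def Polynomial.smult_add_right
      flip: Polynomial.smult_add_left one_pCons)

context vector_space
begin

lemma lin_ext_superset:
  assumes "finite A" "Poly_Mapping.keys a \<subseteq> A"
  shows "lin_ext scale F a = (\<Sum>i\<in>A. scale (Poly_Mapping.lookup a i) (F i))"
  unfolding lin_ext_def
  by (rule sum.mono_neutral_left) (use assms in \<open>auto simp: in_keys_iff\<close>)

lemma lin_ext_add: "lin_ext scale F (a + b) = lin_ext scale F a + lin_ext scale F b"
proof -
  let ?A = "Poly_Mapping.keys a \<union> Poly_Mapping.keys b"
  have "lin_ext scale F c = (\<Sum>i\<in>?A. scale (Poly_Mapping.lookup c i) (F i))"
    if "c \<in> {a, b, a + b}" for c
    by (rule lin_ext_superset) (use that Poly_Mapping.keys_add[of a b] in auto)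
  then show ?thesis
    by (simp add: lookup_add scale_left_distrib sum.distrib)
qed

lemma lin_ext_single [simp]: "lin_ext scale F (Poly_Mapping.single i c) = scale c (F i)"
  by (cases "c = 0") (simp_all add: lin_ext_def)

lemma lin_ext_0 [simp]: "lin_ext scale F 0 = 0"
  by (simp add: lin_ext_def)

lemma lin_ext_minus [simp]: "lin_ext scale F (- a) = - lin_ext scale F a"
  using lin_ext_add[of F a "- a"] by (simp add: eq_neg_iff_add_eq_0 add.commute)

end


lemma (in vector_space) lin_ext_cong_add:
  "lin_ext scale (\<lambda>i. F i + G i) a = lin_ext scale F a + lin_ext scale G a"
  by (simp add: lin_ext_def scale_right_distrib sum.distrib)

lemma (in vector_space) lin_ext_cong_scale:
  "lin_ext scale (\<lambda>i. scale c (F i)) a = scale c (lin_ext scale F a)"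
  by (simp add: lin_ext_def scale_sum_right mult.commute)

lemma lin_ext_scale:
  assumes "vector_space sc"
  shows "lin_ext sc F (hv_scale c a) = sc c (lin_ext sc F a)"
proof -
  interpret vector_space sc by fact
  have "lin_ext sc F (hv_scale c a) =
      (\<Sum>i\<in>Poly_Mapping.keys a. sc (Poly_Mapping.lookup (hv_scale c a) i) (F i))"
    by (rule lin_ext_superset) (auto simp: in_keys_iff)
  then show ?thesis
    by (simp add: lin_ext_def scale_sum_right)
qed

lemma hv_induct [case_names add single]:
  fixes a :: hv
  assumes "\<And>a b. P a \<Longrightarrow> P b \<Longrightarrow> P (a + b)"
    and "\<And>i c. P (Poly_Mapping.single i c)"
  shows "P a"
proof -
  have *: "P (\<Sum>i\<in>A. Poly_Mapping.single i (Poly_Mapping.lookup a i))" if "finite A" for A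
    using that
  proof (induction A)
    case empty
    show ?case using assms(2)[of C1 0] by simp
  qed (auto intro: assms)
  have "a = (\<Sum>i\<in>Poly_Mapping.keys a. Poly_Mapping.single i (Poly_Mapping.lookup a i))"
    by (rule poly_mapping_eqI)
      (auto simp: lookup_sum lookup_single when_def in_keys_iff)
  with * show ?thesis by (metis finite_keys)
qed

global_interpretation HV: vector_space hv_scale by (rule vector_space_hv_scale)

global_interpretation P2: vector_space poly2_scale by (rule vector_space_poly2_scale)

lemma hv_scale_single [simp]: "hv_scale c (Poly_Mapping.single i d) = Poly_Mapping.single i (c * d)"
  by (rule poly_mapping_eqI) (simp add: lookup_single when_def)

lemma hv_bracket_single:
  "hv_bracket (Poly_Mapping.single i c) (Poly_Mapping.single j d) =
    hv_scale (c * d) (hv_basis_bracket i j)"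
  by (simp add: hv_bracket_def)

lemma hv_bracket_add_left: "hv_bracket (a + b) c = hv_bracket a c + hv_bracket b c"
  by (simp add: hv_bracket_def HV.lin_ext_add)

lemma hv_bracket_add_right: "hv_bracket a (b + c) = hv_bracket a b + hv_bracket a c"
  by (simp add: hv_bracket_def HV.lin_ext_add HV.lin_ext_cong_add)

lemma hv_bracket_scale_left: "hv_bracket (hv_scale r a) b = hv_scale r (hv_bracket a b)"
  by (simp add: hv_bracket_def lin_ext_scale vector_space_hv_scale)

lemma hv_bracket_scale_right: "hv_bracket a (hv_scale r b) = hv_scale r (hv_bracket a b)"
  by (simp add: hv_bracket_def lin_ext_scale vector_space_hv_scale HV.lin_ext_cong_scale)

lemma hv_bracket_minus_left: "hv_bracket (- a) b = - hv_bracket a b"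
  using hv_bracket_scale_left[of "-1" a b] by (simp add: HV.scale_minus_left)

lemma hv_bracket_minus_right: "hv_bracket a (- b) = - hv_bracket a b"
  using hv_bracket_scale_right[of a "-1" b] by (simp add: HV.scale_minus_left)

lemma hv_bracket_diff_right: "hv_bracket a (b - c) = hv_bracket a b - hv_bracket a c"
  using hv_bracket_add_right[of a b "- c"] by (simp add: hv_bracket_minus_right)

lemma hv_bracket_0_right [simp]: "hv_bracket a 0 = 0"
  using hv_bracket_scale_right[of a 0 0] by simp

lemma hv_basis_bracket_swap: "hv_basis_bracket j i = - hv_basis_bracket i j"
  by (cases i; cases j)
    (auto intro!: poly_mapping_eqI simp: lookup_add lookup_single when_def field_simps
      add_eq_0_iff power3_eq_cube)

lemma hv_bracket_swap: "hv_bracket b a = - hv_bracket a b"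
proof (induction a arbitrary: b rule: hv_induct)
  case (add a1 a2)
  then show ?case by (simp add: hv_bracket_add_left hv_bracket_add_right)
next
  case (single i c)
  show ?case
  proof (induction b rule: hv_induct)
    case (single j d)
    show ?case
      by (simp add: hv_bracket_single hv_basis_bracket_swap[of j i] mult.commute
          HV.scale_minus_right)
  qed (simp add: hv_bracket_add_left hv_bracket_add_right)
qed

lemma hv_bracket_self: "hv_bracket a a = 0"
proof (rule poly_mapping_eqI)
  fix i
  have "Poly_Mapping.lookup (hv_bracket a a) i = - Poly_Mapping.lookup (hv_bracket a a) i"
    using arg_cong[OF hv_bracket_swap[of a a], of "\<lambda>x. Poly_Mapping.lookup x i"] by simp
  then show "Poly_Mapping.lookup (hv_bracket a a) i = Poly_Mapping.lookup 0 i"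
    by simp
qed

abbreviation (input) bv :: "hv_basis \<Rightarrow> hv" where "bv i \<equiv> Poly_Mapping.single i 1"

lemma int_sum_eq_uminusD: "a + b = - c \<Longrightarrow> c = - a - b" for a b c :: int
  by simp

lemma hv_basis_jacobi:
  "hv_bracket (bv i) (hv_bracket (bv j) (bv k)) + hv_bracket (bv j) (hv_bracket (bv k) (bv i)) +
   hv_bracket (bv k) (hv_bracket (bv i) (bv j)) = 0"
  apply (cases i; cases j; cases k)
  apply (simp_all add: hv_bracket_single hv_bracket_add_right hv_bracket_minus_right hv_bracket_diff_right)
  apply (auto intro!: poly_mapping_eqI simp: lookup_add lookup_single when_def add_eq_0_iff add_ac dest!: int_sum_eq_uminusD)
  apply (simp_all add: lookup_add field_simps power2_eq_square power3_eq_cube lookup_minus lookup_single when_def)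
done

lemma hv_jacobi:
  "hv_bracket a (hv_bracket b c) + hv_bracket b (hv_bracket c a) + hv_bracket c (hv_bracket a b) = 0"
  (is "?J a b c = 0")
proof (induction a arbitrary: b c rule: hv_induct)
  case (add a1 a2)
  have "?J (a1 + a2) b c = ?J a1 b c + ?J a2 b c"
    by (simp add: hv_bracket_add_left hv_bracket_add_right algebra_simps)
  then show ?case by (simp add: add)
next
  case (single i r)
  show ?case
  proof (induction b arbitrary: c rule: hv_induct)
    case (add b1 b2)
    let ?a = "Poly_Mapping.single i r"
    have "?J ?a (b1 + b2) c = ?J ?a b1 c + ?J ?a b2 c"
      by (simp add: hv_bracket_add_left hv_bracket_add_right algebra_simps)
    then show ?case by (simp add: add)
  next
    case (single j s)
    show ?case
    proof (induction c rule: hv_induct)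
      case (add c1 c2)
      let ?a = "Poly_Mapping.single i r" and ?b = "Poly_Mapping.single j s"
      have "?J ?a ?b (c1 + c2) = ?J ?a ?b c1 + ?J ?a ?b c2"
        by (simp add: hv_bracket_add_left hv_bracket_add_right algebra_simps)
      then show ?case by (simp add: add)
    next
      case (single k t)
      have *: "Poly_Mapping.single l u = hv_scale u (bv l)" for l u
        by simp
      have "?J (Poly_Mapping.single i r) (Poly_Mapping.single j s) (Poly_Mapping.single k t) =
        hv_scale (r * s * t) (?J (bv i) (bv j) (bv k))"
        unfolding *[of i r] *[of j s] *[of k t]
          hv_bracket_scale_left hv_bracket_scale_right HV.scale_scale HV.scale_right_distrib
        by (simp add: mult_ac)
      then show ?case by (simp only: hv_basis_jacobi HV.scale_zero_right)
    qed
  qed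
qed

theorem lie_algebra_hv: "lie_algebra hv_scale hv_bracket"
  by unfold_locales
    (fact hv_bracket_add_left hv_bracket_add_right hv_bracket_scale_left hv_bracket_scale_right
      hv_bracket_self hv_jacobi)+

lemma Psi_single: "Psi lam \<beta> (Poly_Mapping.single i c) f = poly2_scale c (Psi_basis lam \<beta> i f)"
  by (simp add: Psi_def)

lemma Psi_add_left: "Psi lam \<beta> (a + b) f = Psi lam \<beta> a f + Psi lam \<beta> b f"
  by (simp add: Psi_def P2.lin_ext_add)

lemma Psi_scale_left: "Psi lam \<beta> (hv_scale r a) f = poly2_scale r (Psi lam \<beta> a f)"
  by (simp add: Psi_def lin_ext_scale vector_space_poly2_scale)

lemma Psi_minus_left: "Psi lam \<beta> (- a) f = - Psi lam \<beta> a f"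
  by (simp add: Psi_def)

lemma Psi_basis_add: "Psi_basis lam \<beta> i (f + g) = Psi_basis lam \<beta> i f + Psi_basis lam \<beta> i g"
  by (cases i) (simp_all add: poly2_scale_def pcompose_add distrib_left
      Polynomial.smult_add_right)

lemma Psi_basis_scale:
  "Psi_basis lam \<beta> i (poly2_scale c f) = poly2_scale c (Psi_basis lam \<beta> i f)"
  by (cases i)
    (simp_all add: poly2_scale_def pcompose_smult Polynomial.smult_add_right mult.commute)

lemma Psi_add_right: "Psi lam \<beta> a (f + g) = Psi lam \<beta> a f + Psi lam \<beta> a g"
  by (simp add: Psi_def Psi_basis_add P2.lin_ext_cong_add)

lemma Psi_scale_right: "Psi lam \<beta> a (poly2_scale c f) = poly2_scale c (Psi lam \<beta> a f)"
  by (simp add: Psi_def Psi_basis_scale P2.lin_ext_cong_scale)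

lemma pcompose_x_var_of_int:
  "pcompose (pcompose f (x_var + of_int n)) (x_var + of_int m) =
   pcompose f (x_var + of_int (m + n))"
  by (simp add: pcompose_assoc[symmetric] pcompose_add pcompose_pCons of_int_poly add_ac)

lemma Psi_basis_bracket:
  assumes "lam \<noteq> 0"
  shows "Psi lam \<beta> (hv_basis_bracket i j) f =
    Psi_basis lam \<beta> i (Psi_basis lam \<beta> j f) - Psi_basis lam \<beta> j (Psi_basis lam \<beta> i f)"
proof -
  define T where "T m h = pcompose h (x_var + of_int m)" for m h
  define K where "K c = [:[:c:]:]" for c :: complex
  have T: "T m (h * k) = T m h * T m k" "T m (h + k) = T m h + T m k"
    "T m [:p:] = [:p:]" "T m x_var = x_var + of_int m" "T m (K c) = K c"
    "T m (of_int n) = of_int n" for m n h k p c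
    by (simp_all add: T_def K_def pcompose_mult pcompose_add pcompose_pCons of_int_poly)
  have TT: "T m (T n h) = T (m + n) h" for m n h
    by (simp add: T_def pcompose_x_var_of_int)
  have K: "K (c * d) = K c * K d" "K (of_int n) = of_int n" "K (- c) = - K c" for c d n
    by (simp_all add: K_def of_int_poly mult.commute)
  have pow: "lam powi (m + n) = lam powi m * lam powi n" for m n
    using assms by (simp add: power_int_add)
  have basis: "Psi_basis lam \<beta> (L m) h = K (lam powi m) * ((x_var + of_int m * [:\<beta>:]) * T m h)"
    "Psi_basis lam \<beta> (H m) h = K (lam powi m) * (y_var * T m h)"
    "Psi_basis lam \<beta> C1 h = 0" "Psi_basis lam \<beta> C2 h = 0" "Psi_basis lam \<beta> C3 h = 0" for m h
    by (simp_all add: poly2_scale_def K_def T_def)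
  have single: "Psi lam \<beta> (Poly_Mapping.single i c) h = K c * Psi_basis lam \<beta> i h" for i c h
    by (simp add: Psi_single poly2_scale_def K_def)
  have central: "Psi_basis lam \<beta> i 0 = 0" for i
    by (cases i) (simp_all add: poly2_scale_def)
  have "Psi lam \<beta> (if P then Poly_Mapping.single C1 c else 0) h = 0"
    "Psi lam \<beta> (if P then Poly_Mapping.single C2 c else 0) h = 0"
    "Psi lam \<beta> (if P then Poly_Mapping.single C3 c else 0) h = 0" for P c h
    by (simp_all add: single basis, simp_all add: Psi_def)
  note C = this
  have LH: "Psi lam \<beta> (hv_basis_bracket (L m) (H n)) f =
    Psi_basis lam \<beta> (L m) (Psi_basis lam \<beta> (H n) f) -
    Psi_basis lam \<beta> (H n) (Psi_basis lam \<beta> (L m) f)" for m n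
    unfolding hv_basis_bracket.simps Psi_add_left single C basis T TT pow K add.commute[of n m]
    by (simp only: algebra_simps) simp
  have LL: "Psi lam \<beta> (hv_basis_bracket (L m) (L n)) f =
    Psi_basis lam \<beta> (L m) (Psi_basis lam \<beta> (L n) f) -
    Psi_basis lam \<beta> (L n) (Psi_basis lam \<beta> (L m) f)" for m n
    unfolding hv_basis_bracket.simps Psi_add_left single C basis T TT pow K add.commute[of n m]
      of_int_add[where 'a = "complex poly poly"] of_int_diff[where 'a = "complex poly poly"]
    by (simp only: algebra_simps) simp
  have HH: "Psi lam \<beta> (hv_basis_bracket (H m) (H n)) f =
    Psi_basis lam \<beta> (H m) (Psi_basis lam \<beta> (H n) f) -
    Psi_basis lam \<beta> (H n) (Psi_basis lam \<beta> (H m) f)" for m n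
    unfolding hv_basis_bracket.simps Psi_add_left single C basis T TT pow K add.commute[of n m]
    by (simp only: algebra_simps add_0_left)
  have HL: "Psi lam \<beta> (hv_basis_bracket (H n) (L m)) f =
    Psi_basis lam \<beta> (H n) (Psi_basis lam \<beta> (L m) f) -
    Psi_basis lam \<beta> (L m) (Psi_basis lam \<beta> (H n) f)" for m n
    unfolding hv_basis_bracket_swap[of "H n" "L m"] Psi_minus_left LH by simp
  have zero: "Psi lam \<beta> 0 h = 0" for h
    by (simp add: Psi_def)
  show ?thesis
    by (cases i; cases j; simp only: LH LL HH HL; simp only: hv_basis_bracket.simps zero basis central diff_zero)
qed

theorem lie_module_Psi:
  assumes "lam \<noteq> 0"
  shows "lie_module hv_scale hv_bracket poly2_scale (Psi lam \<beta>)"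
proof -
  interpret lie_algebra hv_scale hv_bracket by (rule lie_algebra_hv)
  have "Psi lam \<beta> (hv_bracket a b) f =
      Psi lam \<beta> a (Psi lam \<beta> b f) - Psi lam \<beta> b (Psi lam \<beta> a f)" for a b f
  proof (induction a arbitrary: b rule: hv_induct)
    case (single i c)
    show ?case
    proof (induction b rule: hv_induct)
      case (single j d)
      show ?case
        by (simp add: Psi_single Psi_scale_left Psi_basis_scale hv_bracket_single
            Psi_basis_bracket[OF assms] P2.scale_right_diff_distrib mult.commute)
    qed (simp add: hv_bracket_add_right Psi_add_left Psi_add_right)
  qed (simp add: hv_bracket_add_left Psi_add_left Psi_add_right)
  then show ?thesis
    by unfold_locales (simp_all add: Psi_add_left Psi_add_right Psi_scale_left Psi_scale_right)
qed


section \<open>An exceptional maximal submodule\<close>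

text \<open>
  If \<open>\<beta>(0) = 0\<close>, then \<open>S\<^sub>1 = x \<complex>[x,y] + y \<complex>[x,y]\<close> is a submodule of codimension one, hence
  maximal, but it is not of the form \<open>g(y) \<complex>[x,y]\<close>. So in this case a list of the maximal
  submodules has to include \<open>S\<^sub>1\<close>.
\<close>

lemma S_sub_1: "S_sub 1 = {f. coeff (coeff f 0) 0 = 0}"
proof -
  have "\<exists>p q. f = x_var * p + y_var * q" if "coeff (coeff f 0) 0 = 0" for f
  proof -
    obtain c p where f: "f = pCons c p" by (cases f)
    obtain d q where c: "c = pCons d q" by (cases c)
    have "f = x_var * p + y_var * [:q:]"
      using that by (simp add: f c)
    then show ?thesis by blast
  qed
  moreover have "[:1:] * f = f" "coeff (coeff (x_var * p + y_var * q) 0) 0 = 0"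
    for f p q :: "complex poly poly"
    by simp_all
  ultimately show ?thesis
    unfolding S_sub_def by (metis (no_types, opaque_lifting))
qed

lemma maximal_S_sub_1:
  assumes "lam \<noteq> 0" "coeff \<beta> 0 = 0"
  shows "lie_module.maximal_lie_submodule poly2_scale (Psi lam \<beta>) (S_sub 1)"
    and "degree g = 1 \<Longrightarrow> S_sub 1 \<noteq> R_sub g"
proof -
  interpret lie_module hv_scale hv_bracket poly2_scale "Psi lam \<beta>"
    by (rule lie_module_Psi) fact
  have basis: "Psi_basis lam \<beta> i f \<in> S_sub 1" for i f
    by (cases i) (use assms(2) in
      \<open>simp_all add: S_sub_1 poly2_scale_def coeff_mult of_int_poly\<close>)
  have S: "P2.subspace (S_sub 1)"
    by (auto simp: P2.subspace_def S_sub_1 poly2_scale_def)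
  have "Psi lam \<beta> a f \<in> S_sub 1" for a f
    unfolding Psi_def lin_ext_def
    by (intro P2.subspace_sum P2.subspace_scale) (use S basis in auto)
  with S have sub: "lie_submodule (S_sub 1)"
    by (simp add: lie_submodule_def)
  have "1 \<notin> S_sub 1"
    by (simp add: S_sub_1)
  moreover have "W = S_sub 1 \<or> W = UNIV" if W: "lie_submodule W" "S_sub 1 \<subseteq> W" for W
  proof (rule disjCI)
    assume "W \<noteq> UNIV"
    show "W = S_sub 1"
    proof (rule ccontr)
      assume "W \<noteq> S_sub 1"
      then obtain f where f: "f \<in> W" "f \<notin> S_sub 1" using W by auto
      have "h \<in> W" for h
      proof -
        define r where "r = coeff (coeff h 0) 0 / coeff (coeff f 0) 0"
        have "h - poly2_scale r f \<in> S_sub 1"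
          using f(2) by (simp add: S_sub_1 poly2_scale_def r_def)
        then have "h - poly2_scale r f + poly2_scale r f \<in> W"
          using W f(1) by (intro P2.subspace_add P2.subspace_scale) (auto simp: lie_submodule_def)
        then show ?thesis by simp
      qed
      with \<open>W \<noteq> UNIV\<close> show False by auto
    qed
  qed
  ultimately show "maximal_lie_submodule (S_sub 1)"
    using sub by (auto simp: maximal_lie_submodule_def)
  show "S_sub 1 \<noteq> R_sub g" if g: "degree g = 1"
  proof
    assume "S_sub 1 = R_sub g"
    moreover have "x_var \<in> S_sub 1" by (simp add: S_sub_1)
    ultimately obtain f where "x_var = [:g:] * f" by (auto simp: R_sub_def)
    then have "coeff x_var 1 = g * coeff f 1" by simp
    then have "g * coeff f 1 = 1" by simp
    then have "g dvd 1" by (metis dvd_triv_left)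
    with g show False using dvd_imp_degree_le[of g 1] by simp
  qed
qed

end

theory Submission
  imports Defs "HOL-Computational_Algebra.Fundamental_Theorem_Algebra"
begin

text \<open>
  Write \<open>T\<^sup>m f = f(x + m, y)\<close> and \<open>b = \<beta>(0)\<close>, and let \<open>W\<close> be a submodule. Since \<open>L\<^sub>0\<close> and
  \<open>H\<^sub>0\<close> act as multiplication by \<open>x\<close> and \<open>y\<close>, \<open>W\<close> is an ideal of \<open>\<complex>[x,y]\<close>. The operators
  \<open>H\<^sub>m\<close> show that \<open>y T\<^sup>m f \<in> W\<close> for \<open>f \<in> W\<close>. As \<open>\<beta>(y) - b\<close> is a multiple of \<open>y\<close>, this allows
  \<open>\<beta>\<close> to be replaced by \<open>b\<close> in what \<open>L\<^sub>m\<close> gives: \<open>(x + m b) T\<^sup>m f \<in> W\<close>.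

  The main point (\<open>submodule_x_shift\<close>) is that then also \<open>x T\<^sup>m f \<in> W\<close>. Hence \<open>W\<close> lies in
  \<open>K = {f. \<forall>m. x T\<^sup>m f \<in> W \<and> y T\<^sup>m f \<in> W}\<close>, which is an ideal stable under \<open>T\<close>. Such an ideal
  contains all the coefficients \<open>a\<^sub>i(y)\<close> of its elements \<open>\<Sum> a\<^sub>i(y) x\<^sup>i\<close>
  (\<open>shift_stable_ideal_coeffs\<close>): the difference operator \<open>T - 1\<close> lowers the degree in \<open>x\<close>
  and extracts the leading coefficient. If \<open>g\<close> generates the ideal \<open>K \<inter> \<complex>[y]\<close>, it follows
  that \<open>S\<^sub>g \<subseteq> W \<subseteq> R\<^sub>g\<close>; and since \<open>S\<^sub>g\<close> has codimension at most one in \<open>R\<^sub>g\<close>, \<open>W\<close> is one of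
  the two. Conversely, \<open>R\<^sub>g\<close> and \<open>S\<^sub>g\<close> are the images of \<open>\<complex>[x,y]\<close> and \<open>S\<^sub>1\<close> under
  multiplication by \<open>g(y)\<close>, which commutes with the action; and if \<open>b \<noteq> 0\<close>, then \<open>L\<^sub>1\<close> moves
  \<open>g x\<close> out of \<open>S\<^sub>g\<close> for every \<open>g \<noteq> 0\<close>.

  In the quotient by \<open>R\<^sub>g\<close>, a polynomial \<open>p\<close> in \<open>L\<^sub>0\<close> acts as multiplication by \<open>p(x)\<close>, and
  division by \<open>g\<close> of each coefficient \<open>a\<^sub>i(y)\<close> shows that the classes of
  \<open>1, y, \<dots>, y\<^bsup>deg g - 1\<^esup>\<close> form a basis over \<open>\<complex>[L\<^sub>0]\<close>. Finally, a proper submodule \<open>R\<^sub>g\<close> is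
  contained in \<open>R\<^bsub>y - z\<^esub>\<close> for any root \<open>z\<close> of \<open>g\<close>, which gives the maximal submodules.
\<close>

section \<open>Ideals of polynomial rings\<close>

text \<open>
  A commutative ring is a module over itself, and the subspaces of this module are the ideals.
\<close>

interpretation ideal: Modules.module "(*) :: 'a \<Rightarrow> 'a \<Rightarrow> 'a::comm_ring_1"
  by unfold_locales (simp_all add: algebra_simps)

lemma poly_ideal_principal:
  fixes I :: "'k::field poly set"
  assumes "ideal.subspace I"
  shows "\<exists>g. I = {a. g dvd a}"
proof (cases "I = {0}")
  case True
  then show ?thesis by (intro exI[of _ 0]) auto
next
  case False
  then have "\<exists>g. g \<in> I \<and> g \<noteq> 0"
    using ideal.subspace_0[OF assms] by auto
  then obtain g where g: "g \<in> I" "g \<noteq> 0" "\<And>h. h \<in> I \<Longrightarrow> h \<noteq> 0 \<Longrightarrow> degree g \<le> degree h"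
    using ex_has_least_nat[of "\<lambda>g. g \<in> I \<and> g \<noteq> 0" _ degree] by metis
  have "g dvd a" if "a \<in> I" for a
  proof -
    have "a mod g = a - (a div g) * g"
      by (simp add: minus_div_mult_eq_mod)
    then have "a mod g \<in> I"
      using that g(1) assms by (metis ideal.subspace_diff ideal.subspace_scale)
    then have "a mod g = 0"
      using g(2,3) degree_mod_less'[of g a] by fastforce
    then show ?thesis by (simp add: mod_eq_0_iff_dvd)
  qed
  moreover have "a \<in> I" if "g dvd a" for a
    using that g(1) assms by (metis dvdE ideal.subspace_scale mult.commute)
  ultimately show ?thesis by (intro exI[of _ g]) auto
qed

text \<open>
  The analogue for the forward difference of \<open>(x\<^sup>n\<^sup>+\<^sup>1)' = (n + 1) x\<^sup>n\<close>, read off in the top degree.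
  The induction rests on the rule \<open>\<Delta>(a + x p) = p + \<Delta>p + x \<Delta>p\<close>.
\<close>

lemma forward_difference_coeff:
  fixes f :: "'a::comm_ring_1 poly"
  assumes "degree f \<le> Suc n"
  shows "degree (pcompose f [:1, 1:] - f) \<le> n \<and>
    coeff (pcompose f [:1, 1:] - f) n = of_nat (Suc n) * coeff f (Suc n)"
  using assms
proof (induction n arbitrary: f)
  case 0
  obtain a p where f: "f = pCons a p" by (cases f)
  with 0 have "degree p = 0" by (auto split: if_splits)
  then obtain c where "p = [:c:]" by (metis degree_eq_zeroE)
  with f show ?case by (simp add: pcompose_pCons)
next
  case (Suc n)
  obtain a p where f: "f = pCons a p" by (cases f)
  with Suc.prems have p: "degree p \<le> Suc n" by (auto split: if_splits)
  define D where "D = pcompose p [:1, 1:] - p"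
  have D: "degree D \<le> n" "coeff D n = of_nat (Suc n) * coeff p (Suc n)"
    using Suc.IH[OF p] by (auto simp: D_def)
  have *: "pcompose f [:1, 1:] - f = p + D + pCons 0 D"
    by (simp add: f pcompose_pCons D_def algebra_simps)
  have "degree (p + D + pCons 0 D) \<le> Suc n"
    using p D(1) by (intro degree_add_le) (auto simp: degree_pCons_eq_if)
  moreover have "coeff D (Suc n) = 0"
    using D(1) by (simp add: coeff_eq_0)
  ultimately show ?case
    unfolding * by (simp add: D(2) f algebra_simps)
qed

text \<open>
  Repeated differences reduce \<open>f\<close> to a nonzero multiple of its leading coefficient, which is
  therefore in \<open>K\<close>. Subtracting the leading term leaves an element of \<open>K\<close> of smaller degree,
  with the same lower coefficients.
\<close>

lemma shift_stable_ideal_coeffs: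
  fixes K :: "'k::field_char_0 poly poly set"
  assumes K: "ideal.subspace K"
    and shift: "\<And>f. f \<in> K \<Longrightarrow> pcompose f [:1, 1:] \<in> K"
    and "f \<in> K"
  shows "[:coeff f i:] \<in> K"
proof -
  have top: "[:coeff f n:] \<in> K" if "f \<in> K" "degree f \<le> n" for f n
    using that
  proof (induction n arbitrary: f)
    case 0
    then show ?case by (metis degree_eq_zeroE coeff_pCons_0 le_zero_eq)
  next
    case (Suc n)
    let ?D = "pcompose f [:1, 1:] - f"
    have "?D \<in> K"
      using Suc.prems shift K by (simp add: ideal.subspace_diff)
    then have "[:coeff ?D n:] \<in> K"
      using Suc.IH forward_difference_coeff[OF Suc.prems(2)] by blast
    then have "[:[:inverse (of_nat (Suc n)):]:] * [:of_nat (Suc n) * coeff f (Suc n):] \<in> K"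
      using forward_difference_coeff[OF Suc.prems(2)] K ideal.subspace_scale by metis
    moreover have "[:inverse (of_nat (Suc n)):] * (of_nat (Suc n) * a) = a" for a :: "'k poly"
    proof -
      have "[:inverse (of_nat (Suc n)):] * (of_nat (Suc n) :: 'k poly) = 1"
        by (simp add: of_nat_poly one_pCons del: of_nat_Suc)
      then show ?thesis by (metis mult.assoc mult_1)
    qed
    ultimately show ?case by (simp del: of_nat_Suc)
  qed
  have "[:coeff f i:] \<in> K" if "f \<in> K" "degree f \<le> n" for f n
    using that
  proof (induction n arbitrary: f)
    case 0
    then show ?case using top
      by (metis coeff_eq_0 ideal.subspace_0[OF K] le_zero_eq not_gr0 pCons_0_0)
  next
    case (Suc n)
    let ?c = "coeff f (Suc n)"
    have c: "[:?c:] \<in> K" using top Suc.prems by blast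
    have "monom 1 (Suc n) * [:?c:] \<in> K"
      using c K by (rule ideal.subspace_scale[rotated])
    then have "f - monom ?c (Suc n) \<in> K"
      using Suc.prems K ideal.subspace_diff by (simp add: smult_monom)
    moreover have "degree (f - monom ?c (Suc n)) \<le> n"
      using Suc.prems(2) by (intro degree_le) (auto simp: coeff_eq_0)
    ultimately have "[:coeff (f - monom ?c (Suc n)) i:] \<in> K" by (rule Suc.IH)
    then show ?case using c by (cases "i = Suc n") simp_all
  qed
  then show ?thesis using assms(3) by blast
qed


section \<open>The subspaces \<open>R\<^sub>g\<close> and \<open>S\<^sub>g\<close>\<close>

lemma R_sub_iff_dvd: "f \<in> R_sub g \<longleftrightarrow> [:g:] dvd f"
  by (simp only: R_sub_def dvd_def mem_Collect_eq simp_thms)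

lemma R_sub_iff: "f \<in> R_sub g \<longleftrightarrow> (\<forall>i. g dvd coeff f i)"
  by (simp only: R_sub_iff_dvd const_poly_dvd_iff)

lemma R_sub_eq_image: "R_sub g = (*) [:g:] ` UNIV"
  by (auto simp: R_sub_def)

lemma R_sub_mono: "h dvd g \<Longrightarrow> R_sub g \<subseteq> R_sub h"
  unfolding R_sub_iff subset_iff by (meson dvd_trans)

lemma R_sub_eq_UNIV_iff: "R_sub g = UNIV \<longleftrightarrow> is_unit g"
proof
  assume "R_sub g = UNIV"
  then have "1 \<in> R_sub g" by simp
  then show "is_unit g" by (auto simp: R_sub_iff dest!: spec[of _ 0])
qed (auto simp: R_sub_iff unit_imp_dvd)

lemma S_sub_eq_image: "S_sub g = (*) [:g:] ` S_sub 1"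
  by (force simp: S_sub_def)

lemma S_sub_subset_R_sub: "S_sub g \<subseteq> R_sub g"
  by (auto simp: S_sub_def R_sub_def)

lemma S_sub_unit:
  assumes "is_unit g"
  shows "S_sub g = S_sub 1"
proof -
  obtain c where c: "g = [:c:]" "c \<noteq> 0"
    using assms is_unit_poly_iff[of g] by force
  have "f = [:g:] * ([:[:inverse c:]:] * f)" for f
    using c by (simp add: pCons_one)
  moreover have "[:[:inverse c:]:] * f \<in> S_sub 1 \<longleftrightarrow> f \<in> S_sub 1" "[:g:] * f \<in> S_sub 1 \<longleftrightarrow> f \<in> S_sub 1" for f
    using c by (simp_all add: S_sub_1)
  ultimately show ?thesis
    unfolding S_sub_eq_image[of g] by blast
qed

text \<open>
  \<open>S\<^sub>g\<close> is the image under multiplication by \<open>g\<close> of the space \<open>S\<^sub>1\<close> of all polynomials with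
  zero constant term, so any element of \<open>R\<^sub>g\<close> outside \<open>S\<^sub>g\<close> generates \<open>R\<^sub>g\<close> modulo \<open>S\<^sub>g\<close>.
\<close>

lemma subspace_between_S_sub_R_sub:
  assumes W: "P2.subspace W" and "S_sub g \<subseteq> W" "W \<subseteq> R_sub g"
  shows "W = S_sub g \<or> W = R_sub g"
proof (rule disjCI)
  assume "W \<noteq> R_sub g"
  show "W = S_sub g"
  proof (rule ccontr)
    assume "W \<noteq> S_sub g"
    then obtain f where f: "[:g:] * f \<in> W" "[:g:] * f \<notin> S_sub g"
      using assms by (auto simp: R_sub_def)
    define c where "c = coeff (coeff f 0) 0"
    have "c \<noteq> 0"
      using f(2) by (auto simp: S_sub_eq_image[of g] S_sub_1 c_def)
    have "[:g:] * h \<in> W" for h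
    proof -
      define r where "r = coeff (coeff h 0) 0 / c"
      have "h - poly2_scale r f \<in> S_sub 1"
        using \<open>c \<noteq> 0\<close> by (simp add: S_sub_1 poly2_scale_def r_def c_def)
      then have "[:g:] * (h - poly2_scale r f) \<in> W"
        using assms(2) unfolding S_sub_eq_image[of g] by blast
      then have "[:g:] * (h - poly2_scale r f) + poly2_scale r ([:g:] * f) \<in> W"
        by (intro P2.subspace_add P2.subspace_scale W f(1))
      also have "[:g:] * (h - poly2_scale r f) + poly2_scale r ([:g:] * f) = [:g:] * h"
        unfolding poly2_scale_def by (simp only: algebra_simps)
      finally show ?thesis .
    qed
    with \<open>W \<noteq> R_sub g\<close> assms(3) show False by (auto simp: R_sub_def)
  qed
qed


section \<open>\<open>R\<^sub>g\<close> and \<open>S\<^sub>g\<close> as submodules\<close>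

lemma Psi_mult_const: "Psi lam \<beta> a ([:g:] * f) = [:g:] * Psi lam \<beta> a f"
proof -
  have "Psi_basis lam \<beta> i ([:g:] * f) = [:g:] * Psi_basis lam \<beta> i f" for i
    by (cases i) (simp_all only: Psi_basis.simps poly2_scale_def pcompose_mult pcompose_const
        mult_ac mult_zero_right mult_zero_left)
  then show ?thesis
    by (simp only: Psi_def lin_ext_def poly2_scale_def sum_distrib_left mult_ac)
qed

lemma hv_submodule_mult_const:
  assumes "lam \<noteq> 0" "hv_submodule lam \<beta> W"
  shows "hv_submodule lam \<beta> ((*) [:g:] ` W)"
proof -
  interpret lie_module hv_scale hv_bracket poly2_scale "Psi lam \<beta>"
    by (rule lie_module_Psi) fact
  have scale: "poly2_scale c ([:g:] * f) = [:g:] * poly2_scale c f" for c f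
    by (simp only: poly2_scale_def mult_ac)
  have W: "P2.subspace W" "\<And>a f. f \<in> W \<Longrightarrow> Psi lam \<beta> a f \<in> W"
    using assms(2) by (auto simp: lie_submodule_def)
  have "P2.subspace ((*) [:g:] ` W)"
    unfolding P2.subspace_def
  proof (intro conjI ballI allI)
    show "0 \<in> (*) [:g:] ` W"
      using P2.subspace_0[OF W(1)] by force
  next
    fix u v assume "u \<in> (*) [:g:] ` W" "v \<in> (*) [:g:] ` W"
    then show "u + v \<in> (*) [:g:] ` W"
      using P2.subspace_add[OF W(1)] by (auto simp only: distrib_left[symmetric])
  next
    fix c u assume "u \<in> (*) [:g:] ` W"
    then show "poly2_scale c u \<in> (*) [:g:] ` W"
      using P2.subspace_scale[OF W(1)] by (auto simp only: scale)
  qed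
  moreover have "Psi lam \<beta> a f \<in> (*) [:g:] ` W" if "f \<in> (*) [:g:] ` W" for a f
    using that W(2) by (auto simp only: Psi_mult_const)
  ultimately show ?thesis
    by (simp only: lie_submodule_def) blast
qed

lemma hv_submodule_R_sub:
  assumes "lam \<noteq> 0"
  shows "hv_submodule lam \<beta> (R_sub g)"
proof -
  interpret lie_module hv_scale hv_bracket poly2_scale "Psi lam \<beta>"
    by (rule lie_module_Psi) fact
  have "lie_submodule UNIV"
    by (simp add: lie_submodule_def)
  then show ?thesis
    unfolding R_sub_eq_image using assms by (rule hv_submodule_mult_const[rotated])
qed

lemma hv_submodule_S_sub:
  assumes "lam \<noteq> 0" "coeff \<beta> 0 = 0"
  shows "hv_submodule lam \<beta> (S_sub g)"
proof -
  interpret lie_module hv_scale hv_bracket poly2_scale "Psi lam \<beta>"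
    by (rule lie_module_Psi) fact
  show ?thesis
    unfolding S_sub_eq_image[of g]
    using maximal_S_sub_1(1)[OF assms] assms(1)
    by (intro hv_submodule_mult_const) (simp_all add: maximal_lie_submodule_def)
qed

text \<open>
  Applied to \<open>g x\<close>, the operator \<open>L\<^sub>1\<close> gives \<open>\<lambda> g (x + \<beta>) (x + 1)\<close>, whose cofactor of \<open>g\<close> has
  the constant term \<open>\<lambda> \<beta>(0)\<close>.
\<close>

lemma hv_submodule_S_sub_imp_zero:
  assumes "lam \<noteq> 0" "coeff \<beta> 0 \<noteq> 0" "hv_submodule lam \<beta> (S_sub g)"
  shows "g = 0"
proof (rule ccontr)
  assume "g \<noteq> 0"
  interpret lie_module hv_scale hv_bracket poly2_scale "Psi lam \<beta>"
    by (rule lie_module_Psi) fact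
  let ?a = "Poly_Mapping.single (L 1) 1 :: hv"
  have "[:g:] * x_var \<in> S_sub g"
    unfolding S_sub_eq_image[of g] by (rule imageI) (simp add: S_sub_1)
  then have "Psi lam \<beta> ?a ([:g:] * x_var) \<in> S_sub g"
    using assms(3) by (simp only: lie_submodule_def)
  then have "[:g:] * Psi lam \<beta> ?a x_var \<in> (*) [:g:] ` S_sub 1"
    by (simp only: Psi_mult_const S_sub_eq_image[of g])
  then have "Psi lam \<beta> ?a x_var \<in> S_sub 1"
    using \<open>g \<noteq> 0\<close> by (elim imageE) (simp only: mult_left_cancel pCons_eq_0_iff simp_thms)
  moreover have "coeff (coeff (Psi lam \<beta> ?a x_var) 0) 0 = lam * coeff \<beta> 0"
    by (simp add: Psi_single poly2_scale_def pcompose_pCons coeff_mult)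
  ultimately show False
    using assms by (simp add: S_sub_1)
qed

section \<open>The classification of submodules\<close>

definition shift :: "int \<Rightarrow> complex poly poly \<Rightarrow> complex poly poly"
  where "shift m f = pcompose f (x_var + of_int m)"

lemma shift_hom:
  "shift m 0 = 0" "shift m (f + h) = shift m f + shift m h" "shift m (f * h) = shift m f * shift m h"
  "shift m x_var = x_var + of_int m" "shift m [:a:] = [:a:]" "shift m (of_int n) = of_int n"
  by (simp_all add: shift_def pcompose_add pcompose_mult pcompose_pCons of_int_poly)

lemma shift_0: "shift 0 f = f"
  by (simp add: shift_def)

lemma shift_shift: "shift m (shift n f) = shift (m + n) f"
  unfolding shift_def by (rule pcompose_x_var_of_int)

lemma pcompose_eq_shift_1: "pcompose f [:1, 1:] = shift 1 f"
proof -
  have "[:1, 1:] = x_var + of_int 1"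
    by (rule poly_eqI) (simp add: coeff_pCons split: nat.split)
  then show ?thesis by (simp only: shift_def)
qed

context
  fixes lam :: complex and \<beta> :: "complex poly" and W :: "complex poly poly set"
  assumes lam: "lam \<noteq> 0" and W: "hv_submodule lam \<beta> W"
begin

lemma submodule_subspace: "P2.subspace W"
  and submodule_act: "f \<in> W \<Longrightarrow> Psi lam \<beta> a f \<in> W"
proof -
  interpret lie_module hv_scale hv_bracket poly2_scale "Psi lam \<beta>"
    by (rule lie_module_Psi) fact
  show "P2.subspace W" "f \<in> W \<Longrightarrow> Psi lam \<beta> a f \<in> W"
    using W by (auto simp: lie_submodule_def)
qed

lemma submodule_unscale:
  assumes "poly2_scale c f \<in> W" "c \<noteq> 0"
  shows "f \<in> W"
  using P2.subspace_scale[OF submodule_subspace assms(1), of "inverse c"] assms(2) by simp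

lemma submodule_H:
  assumes "f \<in> W"
  shows "y_var * shift m f \<in> W"
proof (rule submodule_unscale)
  show "poly2_scale (lam powi m) (y_var * shift m f) \<in> W"
    using submodule_act[OF assms, of "Poly_Mapping.single (H m) 1"]
    by (simp only: Psi_single P2.scale_one Psi_basis.simps shift_def)
qed (use lam in simp)

lemma submodule_L:
  assumes "f \<in> W"
  shows "(x_var + of_int m * [:\<beta>:]) * shift m f \<in> W"
proof (rule submodule_unscale)
  show "poly2_scale (lam powi m) ((x_var + of_int m * [:\<beta>:]) * shift m f) \<in> W"
    using submodule_act[OF assms, of "Poly_Mapping.single (L m) 1"]
    by (simp only: Psi_single P2.scale_one Psi_basis.simps shift_def)
qed (use lam in simp)

lemma submodule_mult_y: "f \<in> W \<Longrightarrow> y_var * f \<in> W"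
  using submodule_H[of f 0] by (simp only: shift_0)

lemma submodule_mult_x: "f \<in> W \<Longrightarrow> x_var * f \<in> W"
  using submodule_L[of f 0] by (simp only: shift_0 of_int_0 mult_zero_left add_0_right)

lemma submodule_mult_const:
  assumes "f \<in> W"
  shows "[:a:] * f \<in> W"
proof (induction a)
  case 0
  then show ?case using P2.subspace_0[OF submodule_subspace] by simp
next
  case (pCons c a)
  have "[:pCons c a:] * f = poly2_scale c f + y_var * ([:a:] * f)"
    by (simp add: poly2_scale_def flip: smult_add_left)
  then show ?case
    using submodule_mult_y[OF pCons.IH] P2.subspace_add[OF submodule_subspace]
      P2.subspace_scale[OF submodule_subspace assms] by simp
qed

lemma submodule_ideal: "ideal.subspace W"
proof -
  have "p * f \<in> W" if "f \<in> W" for p f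
  proof (induction p)
    case 0
    then show ?case using P2.subspace_0[OF submodule_subspace] by simp
  next
    case (pCons a p)
    have "pCons a p * f = [:a:] * f + x_var * (p * f)"
      by simp
    then show ?case
      using submodule_mult_x[OF pCons.IH] P2.subspace_add[OF submodule_subspace] submodule_mult_const[OF that] by metis
  qed
  then show ?thesis
    using submodule_subspace by (auto simp: P2.subspace_def ideal.subspace_def)
qed

text \<open>
  \<open>\<beta>\<close> may be replaced by its constant term, because the other terms contribute a multiple of
  \<open>y T\<^sup>m f\<close>.
\<close>

lemma submodule_L_const:
  assumes "f \<in> W"
  shows "(x_var + of_int m * [:[:coeff \<beta> 0:]:]) * shift m f \<in> W"
proof -
  obtain b q where \<beta>: "\<beta> = pCons b q" by (cases \<beta>)
  have "[:\<beta>:] = [:[:b:]:] + y_var * [:q:]"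
    by (simp add: \<beta>)
  then have "(x_var + of_int m * [:[:b:]:]) * shift m f =
      (x_var + of_int m * [:\<beta>:]) * shift m f - (of_int m * [:q:]) * (y_var * shift m f)"
    by (simp only: algebra_simps)
  then show ?thesis
    using submodule_L[OF assms, of m] submodule_H[OF assms, of m] submodule_ideal \<beta>
    by (metis coeff_pCons_0 ideal.subspace_diff ideal.subspace_scale)
qed

text \<open>
  The largest shift-stable ideal inside the ideal quotient \<open>W : p\<close>.
\<close>

lemma stable_conductor:
  "ideal.subspace {f. \<forall>m. p * shift m f \<in> W}"
proof (rule ideal.subspaceI; unfold mem_Collect_eq; intro allI)
  show "p * shift m 0 \<in> W" for m
    using ideal.subspace_0[OF submodule_ideal] by (simp add: shift_hom)
  show "p * shift m (f + h) \<in> W"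
    if "\<forall>m. p * shift m f \<in> W" "\<forall>m. p * shift m h \<in> W" for f h m
    using that ideal.subspace_add[OF submodule_ideal] by (simp add: shift_hom distrib_left)
  show "p * shift m (h * f) \<in> W" if "\<forall>m. p * shift m f \<in> W" for f h m
    using ideal.subspace_scale[OF submodule_ideal that[rule_format], of "shift m h"]
    by (simp only: shift_hom mult.left_commute)
qed

lemma stable_conductor_shift:
  "f \<in> {f. \<forall>m. p * shift m f \<in> W} \<Longrightarrow> pcompose f [:1, 1:] \<in> {f. \<forall>m. p * shift m f \<in> W}"
  by (simp only: pcompose_eq_shift_1 shift_shift mem_Collect_eq simp_thms)

text \<open>
  It is known that \<open>(x + m b) T\<^sup>m f \<in> W\<close> for every \<open>f \<in> W\<close>. For \<open>b = 0\<close> this is the claim. If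
  \<open>b \<noteq> 0\<close>, even \<open>T\<^sup>m f \<in> W\<close> holds. Going from \<open>f\<close> to \<open>T\<^sup>m f\<close> in two steps, of lengths \<open>j\<close> and
  \<open>k\<close>, and comparing with the single step gives \<open>j k b (b - 1) T\<^sup>m f \<in> W\<close>, which is enough
  unless \<open>b = 1\<close>. For \<open>b = 1\<close> the product \<open>(x + m b) T\<^sup>m f\<close> is \<open>T\<^sup>m (x f)\<close>. Then \<open>x f\<close> lies in the
  largest shift-stable ideal inside \<open>W\<close>, which therefore contains the coefficients of
  \<open>x f\<close>; these are those of \<open>f\<close>, so \<open>f\<close> lies in it as well.
\<close>

lemma submodule_x_shift:
  assumes f: "f \<in> W"
  shows "x_var * shift m f \<in> W"
proof -
  define b where "b = coeff \<beta> 0"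
  define B where "B = [:[:b:]:]"
  have L0: "(x_var + of_int m * B) * shift m f \<in> W" if "f \<in> W" for f m
    using submodule_L_const[OF that] by (simp only: B_def b_def)
  consider "b = 0" | "b = 1" | "b \<noteq> 0" "b \<noteq> 1" by blast
  then show ?thesis
  proof cases
    case 1
    then show ?thesis using L0[OF f, of m] by (simp add: B_def)
  next
    case 2
    then have "B = 1" by (simp add: B_def flip: one_pCons)
    let ?K = "{f. \<forall>m. 1 * shift m f \<in> W}"
    have "shift m (x_var * f) = (x_var + of_int m * B) * shift m f" for m
      by (simp only: \<open>B = 1\<close> shift_hom mult_1_right)
    then have "x_var * f \<in> ?K"
      using L0[OF f] by simp
    then have "[:coeff (x_var * f) (Suc i):] \<in> ?K" for i
      by (intro shift_stable_ideal_coeffs stable_conductor stable_conductor_shift)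
    then have "[:coeff f i:] \<in> ?K" for i
      by simp
    then have "(\<Sum>i\<le>degree f. monom 1 i * [:coeff f i:]) \<in> ?K"
      by (intro ideal.subspace_sum ideal.subspace_scale stable_conductor)
    also have "(\<Sum>i\<le>degree f. monom 1 i * [:coeff f i:]) = f"
      by (simp add: smult_monom poly_as_sum_of_monoms)
    finally show ?thesis
      using submodule_mult_x by (simp only: mem_Collect_eq mult_1)
  next
    case 3
    \<comment> \<open>Both steps have to be nonzero, so a first step of length 1 is no choice for \<open>m = 1\<close>.\<close>
    obtain j k :: int where jk: "j + k = m" "j \<noteq> 0" "k \<noteq> 0"
      using that[of 1 "m - 1"] that[of 2 "m - 2"] by (cases "m = 1") simp_all
    define h where "h = shift m f"
    have "(x_var + of_int k * B) * shift k ((x_var + of_int j * B) * shift j f) \<in> W"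
      by (intro L0 f)
    also have "shift k ((x_var + of_int j * B) * shift j f) = (x_var + of_int k + of_int j * B) * h"
      by (simp only: jk(1) shift_hom shift_shift h_def B_def add.commute[of k j])
    finally have 1: "(x_var + of_int k * B) * ((x_var + of_int k + of_int j * B) * h) \<in> W" .
    have 2: "(x_var + of_int (j + k) * B) * h \<in> W"
      using L0[OF f, of m] by (simp only: h_def jk(1))
    \<comment> \<open>The cofactor of fact 2 is chosen so that no \<open>x\<close> is left next to \<open>h\<close>.\<close>
    have "(x_var + of_int k * B) * ((x_var + of_int k + of_int j * B) * h) -
        (x_var + of_int k) * ((x_var + of_int (j + k) * B) * h) =
        (of_int j * of_int k * (B * (B - 1))) * h"
      by (simp only: of_int_add algebra_simps mult_1_left)
    with 1 2 have "(of_int j * of_int k * (B * (B - 1))) * h \<in> W"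
      by (metis submodule_ideal ideal.subspace_diff ideal.subspace_scale)
    also have "(of_int j * of_int k * (B * (B - 1))) * h =
        poly2_scale (of_int j * of_int k * (b * (b - 1))) h"
      by (simp add: B_def poly2_scale_def of_int_poly one_pCons)
    finally have "h \<in> W"
      by (rule submodule_unscale) (use 3 jk in simp)
    then show ?thesis using submodule_mult_x by (simp add: h_def)
  qed
qed

text \<open>
  \<open>W\<close> lies in the shift-stable ideal \<open>K\<close>, so that \<open>K \<inter> \<complex>[y]\<close> contains the coefficients of all
  elements of \<open>W\<close>; and \<open>K\<close> is small enough for \<open>x K\<close> and \<open>y K\<close> to be in \<open>W\<close>.
\<close>

lemma submodule_between: "\<exists>g. S_sub g \<subseteq> W \<and> W \<subseteq> R_sub g"
proof -
  let ?C = "\<lambda>p. {f. \<forall>m. p * shift m f \<in> W}"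
  define K where "K = ?C x_var \<inter> ?C y_var"
  have K: "ideal.subspace K"
    unfolding K_def by (intro ideal.subspace_inter stable_conductor)
  have "ideal.subspace {a. [:a:] \<in> K}"
  proof (rule ideal.subspaceI; unfold mem_Collect_eq)
    show "[:0:] \<in> K" using ideal.subspace_0[OF K] by simp
    show "[:a + b:] \<in> K" if "[:a:] \<in> K" "[:b:] \<in> K" for a b
      using ideal.subspace_add[OF K that] by simp
    show "[:c * a:] \<in> K" if "[:a:] \<in> K" for a c
      using ideal.subspace_scale[OF K that, of "[:c:]"] by (simp add: mult.commute)
  qed
  then obtain g where g: "{a. [:a:] \<in> K} = {a. g dvd a}"
    using poly_ideal_principal by blast
  have "W \<subseteq> R_sub g"
  proof
    fix f assume "f \<in> W"
    then have "f \<in> K"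
      using submodule_x_shift submodule_H by (simp add: K_def)
    then have "[:coeff f i:] \<in> K" for i
    proof (rule shift_stable_ideal_coeffs[OF K, rotated])
      show "pcompose f [:1, 1:] \<in> K" if "f \<in> K" for f
        using that stable_conductor_shift unfolding K_def by blast
    qed
    then show "f \<in> R_sub g"
      using g by (auto simp: R_sub_iff)
  qed
  moreover have "S_sub g \<subseteq> W"
  proof
    have "g \<in> {a. g dvd a}" by simp
    then have "[:g:] \<in> K" unfolding g[symmetric] by simp
    then have "x_var * shift 0 [:g:] \<in> W" "y_var * shift 0 [:g:] \<in> W"
      unfolding K_def by blast+
    then have xy: "x_var * [:g:] \<in> W" "y_var * [:g:] \<in> W"
      by (simp_all only: shift_0)
    fix f assume "f \<in> S_sub g"
    then obtain p q where "f = [:g:] * (x_var * p + y_var * q)"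
      by (auto simp: S_sub_def)
    then have "f = p * (x_var * [:g:]) + q * (y_var * [:g:])"
      by (simp only: algebra_simps)
    then show "f \<in> W"
      using xy ideal.subspace_add[OF submodule_ideal] ideal.subspace_scale[OF submodule_ideal] by metis
  qed
  ultimately show ?thesis by blast
qed

lemma submodule_is_S_sub_or_R_sub: "\<exists>g. W = S_sub g \<or> W = R_sub g"
  using submodule_between subspace_between_S_sub_R_sub[OF submodule_subspace] by blast

end


section \<open>The quotients as modules over \<open>\<complex>[L\<^sub>0]\<close>\<close>

text \<open>
  The other embedding of \<open>\<complex>[t]\<close> into \<open>\<complex>[y][x]\<close>, sending \<open>t\<close> to the outer variable.
\<close>

definition poly_in_x :: "complex poly \<Rightarrow> complex poly poly"
  where "poly_in_x p = map_poly (\<lambda>c. [:c:]) p"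

lemma coeff_poly_in_x: "coeff (poly_in_x p) i = [:coeff p i:]"
  by (simp add: poly_in_x_def coeff_map_poly)

lemma poly_in_x_add: "poly_in_x (p + q) = poly_in_x p + poly_in_x q"
  by (rule poly_eqI) (simp add: coeff_poly_in_x)

lemma poly_in_x_pCons: "poly_in_x (pCons c p) = pCons [:c:] (poly_in_x p)"
  by (rule poly_eqI) (simp add: coeff_poly_in_x coeff_pCons split: nat.split)

lemma poly_in_x_0: "poly_in_x 0 = 0"
  by (rule poly_eqI) (simp add: coeff_poly_in_x)

lemma poly_in_x_1: "poly_in_x 1 = 1"
  by (simp add: one_pCons poly_in_x_pCons poly_in_x_0)

lemma poly_in_x_smult: "poly_in_x (Polynomial.smult c p) = [:[:c:]:] * poly_in_x p"
  by (rule poly_eqI) (simp add: coeff_poly_in_x)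

lemma poly_in_x_mult: "poly_in_x (p * q) = poly_in_x p * poly_in_x q"
  by (induction p)
    (simp_all add: poly_in_x_0 poly_in_x_pCons poly_in_x_add poly_in_x_smult)

lemma poly_act_L0:
  assumes "lam \<noteq> 0"
  shows "lie_module.poly_act poly2_scale (Psi lam \<beta>) (Poly_Mapping.single (L 0) 1) p f = poly_in_x p * f"
proof -
  interpret lie_module hv_scale hv_bracket poly2_scale "Psi lam \<beta>"
    by (rule lie_module_Psi) fact
  let ?L0 = "Psi lam \<beta> (Poly_Mapping.single (L 0) 1)"
  have L0: "?L0 h = x_var * h" for h
  proof -
    have "?L0 h = x_var * shift 0 h"
      by (simp add: Psi_single poly2_scale_def shift_def pCons_one)
    then show ?thesis by (simp only: shift_0)
  qed
  have pow: "(?L0 ^^ i) f = monom 1 i * f" for i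
    by (induction i) (simp_all add: L0 monom_Suc)
  have "poly_in_x p = (\<Sum>i\<le>degree p. [:[:coeff p i:]:] * monom 1 i)"
  proof -
    have "[:[:c:]:] * monom 1 i = monom [:c:] i" for c :: complex and i
      by (simp add: smult_monom)
    then show ?thesis
      by (intro poly_eqI) (simp add: coeff_poly_in_x coeff_sum coeff_eq_0)
  qed
  then show ?thesis
    by (simp only: poly_act_def pow poly2_scale_def sum_distrib_right mult.assoc)
qed

lemma coset_eq_iff:
  assumes "ideal.subspace W"
  shows "u +o W = v +o W \<longleftrightarrow> u - v \<in> W"
proof
  assume "u +o W = v +o W"
  moreover have "u \<in> u +o W"
    using ideal.subspace_0[OF assms] by (force simp: elt_set_plus_def)
  ultimately show "u - v \<in> W"
    using set_plus_imp_minus by blast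
next
  assume uv: "u - v \<in> W"
  have "a +o W \<subseteq> b +o W" if "a - b \<in> W" for a b
  proof
    fix f assume "f \<in> a +o W"
    then have "(f - a) + (a - b) \<in> W"
      using set_plus_imp_minus that ideal.subspace_add[OF assms] by blast
    then have "b + (f - b) \<in> b +o W"
      by (intro set_plus_intro2) simp
    then show "f \<in> b +o W" by simp
  qed
  moreover have "v - u \<in> W"
    using ideal.subspace_neg[OF assms uv] by simp
  ultimately show "u +o W = v +o W"
    using uv by blast
qed

lemma ideal_plus_self:
  assumes "ideal.subspace W"
  shows "W + W = W"
proof
  show "W \<subseteq> W + W"
    using ideal.subspace_0[OF assms] by (rule set_zero_plus2)
qed (auto simp: set_plus_def intro: ideal.subspace_add[OF assms])

lemma coset_add:
  assumes "ideal.subspace W"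
  shows "(u +o W) + (v +o W) = (u + v) +o W"
  using ideal_plus_self[OF assms] by (simp add: set_plus_rearrange)

lemma coset_mult:
  assumes "ideal.subspace W"
  shows "(*) c ` (v +o W) + W = (c * v) +o W"
proof
  have "c * (v + w) + w' = c * v + (c * w + w')" for w w'
    by (simp add: algebra_simps)
  then show "(*) c ` (v +o W) + W \<subseteq> (c * v) +o W"
    using ideal.subspace_add[OF assms ideal.subspace_scale[OF assms]]
    by (auto simp: set_plus_def elt_set_plus_def)
  have "c * v \<in> (*) c ` (v +o W)"
    using ideal.subspace_0[OF assms] by (force simp: elt_set_plus_def)
  then show "(c * v) +o W \<subseteq> (*) c ` (v +o W) + W"
    by (rule set_plus_mono3)
qed

lemma ideal_R_sub: "ideal.subspace (R_sub g)"
proof (rule ideal.subspaceI)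
  show "0 \<in> R_sub g" by (simp only: R_sub_iff_dvd dvd_0_right)
  show "u + v \<in> R_sub g" if "u \<in> R_sub g" "v \<in> R_sub g" for u v
    using that unfolding R_sub_iff_dvd by (rule dvd_add)
  show "c * u \<in> R_sub g" if "u \<in> R_sub g" for c u
    using that unfolding R_sub_iff_dvd by (rule dvd_mult)
qed

context
  fixes lam :: complex and \<beta> g :: "complex poly"
  assumes lam: "lam \<noteq> 0"
begin

abbreviation coset :: "complex poly poly \<Rightarrow> complex poly poly set"
  where "coset f \<equiv> f +o R_sub g"

abbreviation Q :: "(complex poly, complex poly poly set) module"
  where "Q \<equiv> L0_quotient lam \<beta> (R_sub g)"

lemma Q_simps:
  "carrier Q = range coset" "zero Q = coset 0" "add Q (coset u) (coset v) = coset (u + v)"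
  "module.smult Q p (coset v) = coset (poly_in_x p * v)"
proof -
  interpret lie_module hv_scale hv_bracket poly2_scale "Psi lam \<beta>"
    by (rule lie_module_Psi) fact
  show "carrier Q = range coset" "zero Q = coset 0" "add Q (coset u) (coset v) = coset (u + v)"
    "module.smult Q p (coset v) = coset (poly_in_x p * v)"
    by (simp_all add: quotient_over_poly_def coset_add coset_mult ideal_R_sub
        poly_act_L0[OF lam, abs_def] cong: image_cong_simp)
qed

lemma ring_of_type_algebra_simps:
  "add ring_of_type_algebra p q = p + q" "monoid.mult ring_of_type_algebra p q = p * q"
  "one ring_of_type_algebra = (1 :: complex poly)"
  by (simp_all add: ring_of_type_algebra_def)

lemma module_Q: "Module.module ring_of_type_algebra Q"
proof (rule moduleI)
  show "cring (ring_of_type_algebra :: complex poly ring)" ..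
  show "abelian_group Q"
  proof (rule abelian_groupI)
    fix A assume "A \<in> carrier Q"
    then obtain u where "A = coset u" by (auto simp: Q_simps)
    then have "coset (- u) \<oplus>\<^bsub>Q\<^esub> A = \<zero>\<^bsub>Q\<^esub>" by (simp add: Q_simps)
    then show "\<exists>B\<in>carrier Q. B \<oplus>\<^bsub>Q\<^esub> A = \<zero>\<^bsub>Q\<^esub>" by (auto simp: Q_simps)
  qed (auto simp: Q_simps add_ac simp del: set_zero_plus)
  show "p \<odot>\<^bsub>Q\<^esub> A \<in> carrier Q" if "A \<in> carrier Q" for p A
    using that unfolding Q_simps(1) by (elim rangeE) (simp only: Q_simps, rule rangeI)
qed (unfold Q_simps(1); elim rangeE; simp only: Q_simps ring_of_type_algebra_simps poly_in_x_add poly_in_x_mult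
    poly_in_x_1 distrib_left distrib_right mult.assoc mult_1)+

lemma finsum_Q:
  assumes "finite A"
  shows "finsum Q (\<lambda>i. coset (f i)) A = coset (\<Sum>i\<in>A. f i)"
proof -
  interpret Module.module ring_of_type_algebra Q by (rule module_Q)
  have Q: "coset u \<in> carrier Q" for u
    unfolding Q_simps by (rule rangeI)
  from assms show ?thesis
  proof induction
    case empty
    show ?case by (simp only: finsum_empty Q_simps sum.empty)
  next
    case (insert i A)
    then have "finsum Q (\<lambda>i. coset (f i)) (insert i A) =
        add Q (coset (f i)) (finsum Q (\<lambda>i. coset (f i)) A)"
      by (intro finsum_insert Pi_I Q)
    then show ?case
      by (simp only: Q_simps insert.IH sum.insert[OF insert.hyps])
  qed
qed

abbreviation y_power :: "nat \<Rightarrow> complex poly poly"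
  where "y_power i \<equiv> [:monom 1 i:]"

text \<open>
  If each coefficient of \<open>f \<in> \<complex>[y][x]\<close> is replaced by its remainder modulo \<open>g(y)\<close>, this is the
  polynomial in \<open>x\<close> that multiplies \<open>y\<^sup>i\<close> in the result: the \<open>i\<close>-th coordinate of the class of
  \<open>f\<close>.
\<close>

definition remainder_coeff :: "nat \<Rightarrow> complex poly poly \<Rightarrow> complex poly"
  where "remainder_coeff i f = map_poly (\<lambda>a. coeff (a mod g) i) f"

text \<open>
  The claim splits over the powers of \<open>x\<close>: for the coefficient of each of them, it says that the
  remainder modulo \<open>g\<close> is the only polynomial of degree below that of \<open>g\<close> in its residue class.
\<close>

lemma remainder_unique:
  assumes "g \<noteq> 0"
  shows "f - (\<Sum>i<degree g. poly_in_x (d i) * y_power i) \<in> R_sub g \<longleftrightarrow>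
    (\<forall>i<degree g. d i = remainder_coeff i f)"
proof -
  define s where "s j = (\<Sum>i<degree g. monom (coeff (d i) j) i)" for j
  have s: "coeff (\<Sum>i<degree g. poly_in_x (d i) * y_power i) j = s j" for j
    by (simp add: coeff_sum s_def coeff_poly_in_x smult_monom mult.commute[of _ "monom _ _"])
  have coeff_s: "coeff (s j) i = (if i < degree g then coeff (d i) j else 0)" for i j
    by (simp add: s_def coeff_sum)
  have rem: "coeff (a mod g) i = 0" if "i \<ge> degree g" for a i
    using degree_mod_less[OF assms, of a] that by (auto intro: coeff_eq_0)
  have "g dvd coeff f j - s j \<longleftrightarrow> coeff f j mod g = s j" for j
  proof -
    have "s j = 0 \<or> degree (s j) < degree g"
      using degree_lessI[of "s j" "degree g"] by (auto simp: coeff_s)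
    then have "s j mod g = s j"
      by (auto simp: mod_poly_less)
    then show ?thesis
      by (metis mod_eq_dvd_iff)
  qed
  also have "coeff f j mod g = s j \<longleftrightarrow> (\<forall>i<degree g. coeff (d i) j = coeff (coeff f j mod g) i)" for j
    using rem by (auto simp: poly_eq_iff coeff_s not_less)
  finally have "g dvd coeff f j - s j \<longleftrightarrow>
      (\<forall>i<degree g. coeff (d i) j = coeff (coeff f j mod g) i)" for j .
  then show ?thesis
    unfolding R_sub_iff coeff_diff s by (auto simp: poly_eq_iff remainder_coeff_def coeff_map_poly)
qed

lemma inj_on_coset_y_power: "inj_on (\<lambda>i. coset (y_power i)) {..<degree g}"
proof (rule inj_onI)
  fix i j assume ij: "i \<in> {..<degree g}" "j \<in> {..<degree g}" "coset (y_power i) = coset (y_power j)"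
  then have "y_power i - y_power j \<in> R_sub g"
    by (simp only: coset_eq_iff[OF ideal_R_sub])
  then have "g dvd monom 1 i - monom 1 j"
    by (auto simp: R_sub_iff dest!: spec[of _ 0])
  moreover have "degree (monom 1 i - monom 1 j :: complex poly) < degree g"
    using ij by (intro degree_diff_less) (simp_all add: degree_monom_eq)
  ultimately have "monom 1 i - monom (1::complex) j = 0"
    using dvd_imp_degree_le not_less by blast
  then show "i = j"
    by (metis degree_monom_eq eq_iff_diff_eq_0 zero_neq_one)
qed

lemma free_module_Q:
  assumes g: "g \<noteq> 0"
  shows "free_module_of_rank ring_of_type_algebra Q (degree g)"
proof -
  interpret Module.module ring_of_type_algebra Q by (rule module_Q)
  let ?e = "\<lambda>i. coset (y_power i)" and ?n = "degree g"
  define B where "B = ?e ` {..<?n}"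
  have B: "B \<subseteq> carrier Q" "finite B" "card B = ?n"
    using inj_on_coset_y_power by (auto simp: B_def Q_simps card_image)
  have UNIV: "carrier (ring_of_type_algebra :: complex poly ring) = UNIV"
    by (simp add: ring_of_type_algebra_def)
  have comb: "(\<Oplus>\<^bsub>Q\<^esub>b\<in>B. c b \<odot>\<^bsub>Q\<^esub> b) = coset (\<Sum>i<?n. poly_in_x (c (?e i)) * y_power i)" for c
  proof -
    have "(\<Oplus>\<^bsub>Q\<^esub>b\<in>B. c b \<odot>\<^bsub>Q\<^esub> b) = finsum Q (\<lambda>i. c (?e i) \<odot>\<^bsub>Q\<^esub> ?e i) {..<?n}"
      unfolding B_def by (rule finsum_reindex) (auto simp: Q_simps inj_on_coset_y_power)
    also have "\<dots> = coset (\<Sum>i<?n. poly_in_x (c (?e i)) * y_power i)"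
      by (simp only: Q_simps finsum_Q finite_lessThan)
    finally show ?thesis .
  qed
  have "\<exists>!c. c \<in> B \<rightarrow>\<^sub>E UNIV \<and> v = (\<Oplus>\<^bsub>Q\<^esub>b\<in>B. c b \<odot>\<^bsub>Q\<^esub> b)" if v_Q: "v \<in> carrier Q" for v
  proof -
    obtain f where v: "v = coset f" using v_Q by (auto simp: Q_simps)
    define D where "D i = remainder_coeff i f" for i
    have iff: "v = (\<Oplus>\<^bsub>Q\<^esub>b\<in>B. c b \<odot>\<^bsub>Q\<^esub> b) \<longleftrightarrow> (\<forall>i<?n. c (?e i) = D i)" for c
      unfolding comb v D_def
      by (simp only: coset_eq_iff[OF ideal_R_sub] remainder_unique[OF g])
    show ?thesis
    proof (rule ex1I)
      let ?c = "\<lambda>b\<in>B. D (the_inv_into {..<?n} ?e b)"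
      show "?c \<in> B \<rightarrow>\<^sub>E UNIV \<and> v = (\<Oplus>\<^bsub>Q\<^esub>b\<in>B. ?c b \<odot>\<^bsub>Q\<^esub> b)"
        unfolding iff using the_inv_into_f_f[OF inj_on_coset_y_power]
        by (auto simp: B_def)
      show "c = ?c" if "c \<in> B \<rightarrow>\<^sub>E UNIV \<and> v = (\<Oplus>\<^bsub>Q\<^esub>b\<in>B. c b \<odot>\<^bsub>Q\<^esub> b)" for c
      proof (rule PiE_ext[of _ B "\<lambda>_. UNIV"])
        show "c b = ?c b" if "b \<in> B" for b
          using that \<open>c \<in> B \<rightarrow>\<^sub>E UNIV \<and> _\<close> the_inv_into_f_f[OF inj_on_coset_y_power]
          unfolding iff by (auto simp: B_def)
      qed (use that in auto)
    qed
  qed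
  then show ?thesis
    unfolding free_module_of_rank_def UNIV
    by (intro conjI module_Q exI[of _ B] B ballI)
qed

end


section \<open>The maximal submodules\<close>

text \<open>
  A proper \<open>R\<^sub>g\<close> has a non-unit \<open>g\<close>, hence one with a root \<open>z\<close>, and \<open>R\<^sub>g \<subseteq> R\<^bsub>y - z\<^esub> \<noteq> \<complex>[x,y]\<close>. A
  maximal \<open>S\<^sub>g\<close> can differ from \<open>R\<^sub>g\<close> only if \<open>R\<^sub>g\<close> is everything; then \<open>g\<close> is a unit.
\<close>

lemma maximal_hv_submodule_cases:
  assumes "lam \<noteq> 0" and max: "maximal_hv_submodule lam \<beta> W"
  shows "(\<exists>g. degree g = 1 \<and> W = R_sub g) \<or> (coeff \<beta> 0 = 0 \<and> W = S_sub 1)"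
proof -
  interpret lie_module hv_scale hv_bracket poly2_scale "Psi lam \<beta>"
    by (rule lie_module_Psi) fact
  have W: "hv_submodule lam \<beta> W" "W \<noteq> UNIV"
    and W_max: "\<And>h. W \<subseteq> R_sub h \<Longrightarrow> R_sub h = W \<or> R_sub h = UNIV"
    using max hv_submodule_R_sub[OF assms(1)] by (auto simp: maximal_lie_submodule_def)
  have R: "\<exists>h. degree h = 1 \<and> W = R_sub h" if "W = R_sub g" for g
  proof -
    have "\<not> is_unit g"
      using that W(2) R_sub_eq_UNIV_iff by blast
    have "\<exists>z. poly g z = 0"
    proof (cases "degree g = 0")
      case True
      then show ?thesis
        using \<open>\<not> is_unit g\<close> by (metis is_unit_iff_degree poly_0)
    next
      case False
      then show ?thesis
        using fundamental_theorem_of_algebra by (metis constant_degree)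
    qed
    then obtain z where "[:-z, 1:] dvd g"
      by (auto simp: poly_eq_0_iff_dvd)
    then have "W \<subseteq> R_sub [:-z, 1:]"
      using that R_sub_mono by blast
    moreover have "R_sub [:-z, 1:] \<noteq> UNIV"
      by (simp add: R_sub_eq_UNIV_iff is_unit_iff_degree)
    ultimately have "W = R_sub [:-z, 1:]"
      using W_max by blast
    then show ?thesis by (intro exI[of _ "[:-z, 1:]"]) simp
  qed
  obtain g where "W = S_sub g \<or> W = R_sub g"
    using submodule_is_S_sub_or_R_sub[OF assms(1) W(1)] by blast
  then show ?thesis
  proof
    assume S: "W = S_sub g"
    then have "R_sub g = W \<or> R_sub g = UNIV"
      using W_max S_sub_subset_R_sub by blast
    then show ?thesis
    proof
      assume "R_sub g = UNIV"
      then have "is_unit g" by (simp add: R_sub_eq_UNIV_iff)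
      moreover from this have "g \<noteq> 0" by auto
      ultimately show ?thesis
        using S W(1) S_sub_unit hv_submodule_S_sub_imp_zero[OF assms(1)] by blast
    qed (use R in blast)
  qed (use R in blast)
qed

theorem proposition5p1:
  fixes lam :: complex and \<beta> :: "complex poly"
  assumes "lam \<noteq> 0"
  shows
    "(coeff \<beta> 0 \<noteq> 0 \<longrightarrow>
        {W. hv_submodule lam \<beta> W} = {R_sub g | g. True} \<and>
        (\<forall>g h. h dvd g \<longrightarrow> R_sub g \<subseteq> R_sub h)) \<and>
     (coeff \<beta> 0 = 0 \<longrightarrow>
        {W. hv_submodule lam \<beta> W} = {R_sub g | g. True} \<union> {S_sub g | g. True} \<and>
        (\<forall>g h. h dvd g \<longrightarrow> S_sub g \<subseteq> R_sub g \<and> R_sub g \<subseteq> R_sub h)) \<and>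
     (\<forall>g. g \<noteq> 0 \<longrightarrow>
        free_module_of_rank ring_of_type_algebra (L0_quotient lam \<beta> (R_sub g)) (degree g)) \<and>
     (\<forall>W. maximal_hv_submodule lam \<beta> W \<longrightarrow>
        (\<exists>g. degree g = 1 \<and> W = R_sub g) \<or> (coeff \<beta> 0 = 0 \<and> W = S_sub 1))"
proof -
  note cases = submodule_is_S_sub_or_R_sub[OF assms, of \<beta>]
  have "{W. hv_submodule lam \<beta> W} = {R_sub g | g. True}" if "coeff \<beta> 0 \<noteq> 0"
  proof -
    have "S_sub 0 = R_sub 0"
      by (auto simp: S_sub_def R_sub_def)
    then have "\<exists>g. W = R_sub g" if "hv_submodule lam \<beta> W" for W
      using cases[OF that] hv_submodule_S_sub_imp_zero[OF assms \<open>coeff \<beta> 0 \<noteq> 0\<close>] that by blast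
    then show ?thesis
      using hv_submodule_R_sub[OF assms] by blast
  qed
  moreover have "{W. hv_submodule lam \<beta> W} = {R_sub g | g. True} \<union> {S_sub g | g. True}"
    if "coeff \<beta> 0 = 0"
    using cases hv_submodule_R_sub[OF assms, of \<beta>] hv_submodule_S_sub[OF assms that] by blast
  ultimately show ?thesis
    using R_sub_mono S_sub_subset_R_sub free_module_Q[OF assms]
      maximal_hv_submodule_cases[OF assms] by simp
qed

end
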